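(* Let $n$ and $m$ be non-negative co-prime integers with $n\le m$ (so $m\geq 1$), and let $b\le 1$ be a real number. Put $a=-n/m$. Then $$ W\left(-\tfrac{n}{m},\, b \,\middle|\, z\right)=\sum_{r=0}^{m-1}\frac{z^r}{r!\,\Gamma(b+ar)}\;{}_{n+1}F_{m}\left(1,\,b'_0,\ldots,b'_{n-1};\;c_0,\ldots,c_{m-1}\,\middle|\,\frac{(-1)^n\,n^n\,z^m}{m^m}\right), $$ where, for each $r$, $$ b'_j=1+\frac{r}{m}-\frac{b+j}{n}\quad(0\le j\le n-1),\qquad c_j=\frac{r+1+j}{m}\quad(0\le j\le m-1). $$ The identity holds for every $z\in\mathbb{C}$ if $n<m$, and for every $z\in\mathbb{C}$ with $|z|<1$ if $n=m=1$.
   Context: The Wright function is defined by the series $W(a,b\,|\,z)=\sum_{k=0}^{\infty}\frac{z^k}{k!\,\Gamma(ak+b)}$, where $1/\Gamma$ is the entire reciprocal Gamma function, so $1/\Gamma(x)=0$ at $x=0,-1,-2,\ldots$. The same series is used for $a=-1$ where it converges ($|z|<1$). The generalized hypergeometric function is $${}_pF_q(\alpha_0,\ldots,\alpha_{p-1};\beta_0,\ldots,\beta_{q-1}\,|\,z)=\sum_{k=0}^{\infty}\frac{z^k}{k!}\,\frac{\prod_{j=0}^{p-1}(\alpha_j)_k}{\prod_{j=0}^{q-1}(\beta_j)_k},$$ where $(\alpha)_k=\alpha(\alpha+1)\cdots(\alpha+k-1)$ is the rising factorial and $(\alpha)_0=1$. Equal numerator and denominator parameters cancel. If $n=0$, the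 list $b'_0,\ldots,b'_{n-1}$ is empty and $n^n=0^0=1$. *)

theory Defs
  imports "HOL-Analysis.Analysis"
begin

definition wright_term :: "complex \<Rightarrow> complex \<Rightarrow> complex \<Rightarrow> nat \<Rightarrow> complex" where
  "wright_term a b z k = z ^ k / fact k * rGamma (a * of_nat k + b)"

definition wright :: "complex \<Rightarrow> complex \<Rightarrow> complex \<Rightarrow> complex" where
  "wright a b z = (\<Sum>k. wright_term a b z k)"

(* The list lengths play the role of p and q.  If some entry of bs is a non-positive integer,
   late terms are divided by zero and hence are 0. *)

definition hypergeom_term :: "complex list \<Rightarrow> complex list \<Rightarrow> complex \<Rightarrow> nat \<Rightarrow> complex" where
  "hypergeom_term as bs z k =
     z ^ k / fact k * ((\<Prod>\<alpha>\<leftarrow>as. pochhammer \<alpha> k) / (\<Prod>\<beta>\<leftarrow>bs. pochhammer \<beta> k))"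

definition hypergeom :: "complex list \<Rightarrow> complex list \<Rightarrow> complex \<Rightarrow> complex" where
  "hypergeom as bs z = (\<Sum>k. hypergeom_term as bs z k)"

lemma hypergeom_term_eq_fps_hypergeo:
  "hypergeom_term as bs z k = fps_nth (fps_hypergeo as bs 1) k * z ^ k"
proof -
  have *: "foldl (\<lambda>r x. r * pochhammer x k) v xs = v * (\<Prod>x\<leftarrow>xs. pochhammer x k)"
    for v :: complex and xs
    by (induction xs arbitrary: v) (simp_all add: mult.assoc)
  show ?thesis
    by (simp add: hypergeom_term_def * mult.commute)
qed

lemma hypergeom_eq_eval_fps:
  "hypergeom as bs z = eval_fps (fps_hypergeo as bs 1) z"
  unfolding hypergeom_def eval_fps_def hypergeom_term_eq_fps_hypergeo ..

end

theory Submission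
  imports Defs
begin

text \<open>
  The Wright series is split according to the residue \<open>r\<close> of the summation index modulo \<open>m\<close>.
  Put \<open>x = b - n r / m\<close>. Along the class \<open>k = r + m l\<close> the argument of the reciprocal Gamma
  function is \<open>x - n l\<close>, that is, \<open>x\<close> moved down by the integer \<open>n l\<close>. The functional equation
  then turns \<open>1 / \<Gamma>(x - n l)\<close> into \<open>1 / \<Gamma>(x)\<close> times \<open>(-1)^(n l) (1 - x)_(n l)\<close>, and
  \<open>k! = r! (r + 1)_(m l)\<close>. By the multiplication formula (\<open>pochhammer_multiplication\<close>) these two
  long rising factorials are products of rising factorials of length \<open>l\<close> with the parameters
  \<open>b'_j\<close> and \<open>c_j\<close>. The powers of \<open>n\<close> and \<open>m\<close> that appear are absorbed in the argument, and the
  numerator parameter \<open>1\<close> cancels the \<open>l!\<close> of the hypergeometric series. So each class is, term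
  by term, a multiple of one of the hypergeometric series (\<open>wright_term_residue_class\<close>).

  Since \<open>1/\<Gamma>\<close> is entire, this also covers the poles of \<open>\<Gamma>\<close>. A class whose coefficient
  \<open>1 / \<Gamma>(x)\<close> vanishes consists of zeros on both sides, and its hypergeometric series still has
  to converge, so convergence is derived from the hypergeometric side. There the ratio test
  applies (\<open>summable_hypergeom_term\<close>), with \<open>n + 1\<close> numerator parameters against \<open>m\<close>
  denominator parameters. Convergent sums over the finitely many residue classes then
  combine into the whole series (\<open>sums_residue_classes\<close>).
\<close>

section \<open>Convergence of hypergeometric series\<close>

lemma prod_list_pochhammer_Suc:
  fixes as :: "'a :: comm_semiring_1 list"
  shows "(\<Prod>\<alpha>\<leftarrow>as. pochhammer \<alpha> (Suc k)) =
         (\<Prod>\<alpha>\<leftarrow>as. pochhammer \<alpha> k) * (\<Prod>\<alpha>\<leftarrow>as. \<alpha> + of_nat k)"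
  by (induction as) (simp_all add: pochhammer_Suc mult_ac)

lemma tendsto_prod_list_shift_over_power:
  fixes as :: "complex list"
  shows "(\<lambda>k. (\<Prod>\<alpha>\<leftarrow>as. \<alpha> + of_nat k) / of_nat k ^ length as) \<longlonglongrightarrow> 1"
proof (induction as)
  case (Cons \<alpha> as)
  have "(\<lambda>k. \<alpha> / of_nat k + 1) \<longlonglongrightarrow> 0 + 1"
    by (intro tendsto_add lim_const_over_n tendsto_const)
  moreover have "\<forall>\<^sub>F k in sequentially. \<alpha> / of_nat k + 1 = (\<alpha> + of_nat k) / of_nat k"
    using eventually_gt_at_top[of 0] by eventually_elim (simp add: field_simps)
  ultimately have "(\<lambda>k. (\<alpha> + of_nat k) / of_nat k) \<longlonglongrightarrow> 1"
    by (simp add: tendsto_cong)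
  from tendsto_mult[OF this Cons.IH] show ?case
    by simp
qed simp

text \<open>
  Consecutive terms differ by the factor \<open>z\<close> times a rational function of the index with
  \<open>length as\<close> linear factors above and \<open>length bs + 1\<close> below, where the additional one comes
  from the factorial. With fewer factors above than below it tends to \<open>0\<close>, with equally many
  to \<open>z\<close>. Division by zero does no harm: it makes both sides of the recurrence zero.
\<close>

lemma summable_hypergeom_term:
  assumes "length as \<le> length bs \<or> length as = Suc (length bs) \<and> cmod z < 1"
  shows "summable (hypergeom_term as bs z)"
proof -
  define P where "P = (\<lambda>xs k. (\<Prod>x\<leftarrow>xs. x + of_nat k :: complex))"
  define L :: complex where "L = (if length as = Suc (length bs) then 1 else 0)"
  define \<rho> where "\<rho> = (\<lambda>k. z * (P as k / P (1 # bs) k))"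
  have rec: "hypergeom_term as bs z (Suc k) = \<rho> k * hypergeom_term as bs z k" for k
    unfolding hypergeom_term_def prod_list_pochhammer_Suc \<rho>_def P_def
    by (simp add: field_simps)
  have powers: "(\<lambda>k. of_nat k ^ length as / of_nat k ^ length (1 # bs) :: complex) \<longlonglongrightarrow> L"
  proof (cases "length as = Suc (length bs)")
    case True
    have "\<forall>\<^sub>F k in sequentially.
            of_nat k ^ length as / of_nat k ^ length (1 # bs) = (1 :: complex)"
      using eventually_gt_at_top[of 0] by eventually_elim (simp add: True)
    thus ?thesis
      by (simp add: L_def True tendsto_eventually)
  next
    case False
    define d where "d = length bs - length as"
    have len: "length bs = length as + d"
      using assms False by (auto simp: d_def)
    have "(\<lambda>k. (1 / of_nat k :: complex) ^ Suc d) \<longlonglongrightarrow> 0 ^ Suc d"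
      by (intro tendsto_power lim_1_over_n)
    moreover have "\<forall>\<^sub>F k in sequentially. (1 / of_nat k :: complex) ^ Suc d =
                     of_nat k ^ length as / of_nat k ^ length (1 # bs)"
      using eventually_gt_at_top[of 0]
      by eventually_elim (simp add: len power_add field_simps)
    ultimately show ?thesis
      using False by (simp add: L_def tendsto_cong)
  qed
  have "(\<lambda>k. z * ((P as k / of_nat k ^ length as) / (P (1 # bs) k / of_nat k ^ length (1 # bs)) *
               (of_nat k ^ length as / of_nat k ^ length (1 # bs)))) \<longlonglongrightarrow> z * (1 / 1 * L)"
    unfolding P_def
    by (intro tendsto_mult tendsto_divide tendsto_const tendsto_prod_list_shift_over_power powers) simp
  moreover have "\<forall>\<^sub>F k in sequentially.
      z * ((P as k / of_nat k ^ length as) / (P (1 # bs) k / of_nat k ^ length (1 # bs)) *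
           (of_nat k ^ length as / of_nat k ^ length (1 # bs))) = \<rho> k"
    using eventually_gt_at_top[of 0] by eventually_elim (simp add: \<rho>_def)
  ultimately have "\<rho> \<longlonglongrightarrow> z * L"
    by (simp add: tendsto_cong)
  hence lim: "(\<lambda>k. cmod (\<rho> k)) \<longlonglongrightarrow> cmod (z * L)"
    by (rule tendsto_norm)
  have "cmod (z * L) < 1"
    using assms by (auto simp: L_def)
  then obtain c where c: "cmod (z * L) < c" "c < 1"
    using dense by blast
  from order_tendstoD(2)[OF lim c(1)] obtain N where N: "\<And>k. k \<ge> N \<Longrightarrow> cmod (\<rho> k) < c"
    by (auto simp: eventually_sequentially)
  show ?thesis
  proof (rule summable_ratio_test[OF c(2)])
    fix k assume "k \<ge> N"
    thus "cmod (hypergeom_term as bs z (Suc k)) \<le> c * cmod (hypergeom_term as bs z k)"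
      using N[of k] by (simp add: rec norm_mult mult_right_mono)
  qed
qed

section \<open>Recombining residue classes\<close>

text \<open>
  No absolute convergence is involved: extending each class by zeros gives \<open>m\<close> convergent
  series, and the whole series is their sum in the given order.
\<close>

lemma sums_residue_classes:
  fixes f :: "nat \<Rightarrow> 'a :: real_normed_vector"
  assumes "m > 0" and "\<And>r. r < m \<Longrightarrow> (\<lambda>l. f (r + m * l)) sums s r"
  shows "f sums (\<Sum>r<m. s r)"
proof -
  have "(\<lambda>k. if k mod m = r then f k else 0) sums s r" if r: "r < m" for r
  proof -
    have "strict_mono (\<lambda>l. r + m * l)"
      using \<open>m > 0\<close> by (intro strict_monoI) simp
    moreover have "(if k mod m = r then f k else 0) = 0" if "k \<notin> range (\<lambda>l. r + m * l)" for k
    proof -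
      have "k mod m \<noteq> r"
        using that mod_mult_div_eq[of k m] by (metis rangeI)
      thus ?thesis by simp
    qed
    ultimately have "(\<lambda>l. if (r + m * l) mod m = r then f (r + m * l) else 0) sums s r \<longleftrightarrow>
                     (\<lambda>k. if k mod m = r then f k else 0) sums s r"
      by (rule sums_mono_reindex)
    thus ?thesis
      using assms(2)[OF r] r by simp
  qed
  hence "(\<lambda>k. \<Sum>r<m. if k mod m = r then f k else 0) sums (\<Sum>r<m. s r)"
    by (intro sums_sum) simp
  also have "(\<lambda>k. \<Sum>r<m. if k mod m = r then f k else 0) = f"
    using \<open>m > 0\<close> by (auto simp: sum.delta')
  finally show ?thesis .
qed

section \<open>The Wright series at a negative rational parameter\<close>

text \<open>
  The \<open>m l\<close> factors \<open>x, x + 1, ...\<close> fall into \<open>m\<close> arithmetic progressions of step \<open>m\<close>; each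
  becomes a rising factorial after division by \<open>m\<close>. The case \<open>m = 0\<close> holds because both
  sides are empty products.
\<close>

lemma pochhammer_multiplication:
  fixes x :: "'a :: field_char_0"
  shows "pochhammer x (m * l) =
         of_nat m ^ (m * l) * (\<Prod>j<m. pochhammer ((x + of_nat j) / of_nat m) l)"
proof (cases "m = 0")
  case False
  show ?thesis
  proof (induction l)
    case (Suc l)
    have "pochhammer (x + of_nat (m * l)) m = (\<Prod>j<m. x + of_nat (m * l) + of_nat j)"
      by (simp add: pochhammer_prod atLeast0LessThan)
    also have "\<dots> = (\<Prod>j<m. of_nat m * ((x + of_nat j) / of_nat m + of_nat l))"
      using False by (intro prod.cong) (simp_all add: field_simps)
    also have "\<dots> = of_nat m ^ m * (\<Prod>j<m. (x + of_nat j) / of_nat m + of_nat l)"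
      by (simp add: prod.distrib)
    finally have step: "pochhammer (x + of_nat (m * l)) m =
                        of_nat m ^ m * (\<Prod>j<m. (x + of_nat j) / of_nat m + of_nat l)" .
    have "pochhammer x (m * Suc l) = pochhammer x (m * l) * pochhammer (x + of_nat (m * l)) m"
      using pochhammer_product'[of x "m * l" m] by (simp add: add.commute)
    also have "\<dots> = of_nat m ^ (m * Suc l) * (\<Prod>j<m. pochhammer ((x + of_nat j) / of_nat m) (Suc l))"
      unfolding step Suc.IH by (simp add: pochhammer_Suc prod.distrib power_add mult_ac)
    finally show ?case .
  qed simp
qed simp

lemma rGamma_minus_of_nat:
  fixes x :: complex
  shows "rGamma (x - of_nat N) = (- 1) ^ N * pochhammer (1 - x) N * rGamma x"
proof -
  have "rGamma (x - of_nat N) = pochhammer (x - of_nat N) N * rGamma x"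
    using pochhammer_rGamma[of "x - of_nat N" N] by simp
  also have "pochhammer (x - of_nat N) N = (- 1) ^ N * pochhammer (1 - x) N"
    using pochhammer_minus'[of "1 - x" N] pochhammer_minus[of "of_nat N - x" N]
    by (simp add: algebra_simps)
  finally show ?thesis .
qed

text \<open>
  The splitting of \<open>(1 - x)_(n l)\<close> yields the parameters \<open>b'_j\<close> in reverse order of \<open>j\<close>.
\<close>

lemma pochhammer_numerator_parameters:
  fixes b :: complex
  assumes "m > 0"
  shows "pochhammer (1 - (b - of_nat n * of_nat r / of_nat m)) (n * l) = of_nat n ^ (n * l) *
         (\<Prod>j<n. pochhammer (1 + of_nat r / of_nat m - (b + of_nat j) / of_nat n) l)"
proof -
  have "(\<Prod>j<n. pochhammer ((1 - (b - of_nat n * of_nat r / of_nat m) + of_nat j) / of_nat n) l) =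
        (\<Prod>j<n. pochhammer ((1 - (b - of_nat n * of_nat r / of_nat m) + of_nat (n - Suc j))
                             / of_nat n) l)"
    by (rule prod.nat_diff_reindex[symmetric])
  also have "\<dots> = (\<Prod>j<n. pochhammer (1 + of_nat r / of_nat m - (b + of_nat j) / of_nat n) l)"
  proof (intro prod.cong refl arg_cong2[where f = pochhammer])
    fix j assume "j \<in> {..<n}"
    thus "(1 - (b - of_nat n * of_nat r / of_nat m) + of_nat (n - Suc j)) / of_nat n =
          1 + of_nat r / of_nat m - (b + of_nat j) / of_nat n"
      using assms by (simp add: of_nat_diff Suc_le_eq) (simp add: field_simps)
  qed
  finally show ?thesis
    by (simp add: pochhammer_multiplication)
qed

lemma wright_term_residue_class:
  fixes b z :: complex
  assumes "m > 0"
  shows "wright_term (- (of_nat n / of_nat m)) b z (r + m * l) =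
    z ^ r / fact r * rGamma (b - of_nat n * of_nat r / of_nat m) *
    hypergeom_term
      (1 # map (\<lambda>j. 1 + of_nat r / of_nat m - (b + of_nat j) / of_nat n) [0..<n])
      (map (\<lambda>j. (of_nat r + 1 + of_nat j) / of_nat m) [0..<m])
      ((- 1) ^ n * of_nat n ^ n * z ^ m / of_nat m ^ m) l"
proof -
  define x where "x = b - of_nat n * of_nat r / of_nat m"
  define A where "A = (\<Prod>j<n. pochhammer (1 + of_nat r / of_nat m - (b + of_nat j) / of_nat n) l)"
  define B where "B = (\<Prod>j<m. pochhammer ((of_nat r + 1 + of_nat j) / of_nat m :: complex) l)"
  have list_prod: "(\<Prod>j\<leftarrow>[0..<k]. g j) = (\<Prod>j<k. g j)" for g :: "nat \<Rightarrow> complex" and k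
    by (simp add: prod.distinct_set_conv_list[symmetric] atLeast0LessThan)
  have arg: "- (of_nat n / of_nat m) * of_nat (r + m * l) + b = x - of_nat (n * l)"
    using assms by (simp add: x_def field_simps)
  have rG: "rGamma (x - of_nat (n * l)) = (- 1) ^ (n * l) * (of_nat n ^ (n * l) * A) * rGamma x"
    unfolding rGamma_minus_of_nat x_def A_def pochhammer_numerator_parameters[OF assms] ..
  have "fact (r + m * l) = (fact r * pochhammer (of_nat r + 1) (m * l) :: complex)"
    using pochhammer_product'[of "1 :: complex" r "m * l"]
    by (simp add: pochhammer_fact add.commute)
  hence fact: "fact (r + m * l) = (fact r * (of_nat m ^ (m * l) * B) :: complex)"
    by (simp add: B_def pochhammer_multiplication)
  have hyp: "hypergeom_term
      (1 # map (\<lambda>j. 1 + of_nat r / of_nat m - (b + of_nat j) / of_nat n) [0..<n])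
      (map (\<lambda>j. (of_nat r + 1 + of_nat j) / of_nat m) [0..<m]) w l = w ^ l * A / B" for w
    by (simp add: hypergeom_term_def A_def B_def list_prod o_def pochhammer_fact[symmetric])
  show ?thesis
    unfolding wright_term_def arg rG fact hyp x_def[symmetric]
    by (simp add: power_add power_mult power_mult_distrib power_divide)
qed

theorem theorem2:
  fixes n m :: nat and b :: real and z :: complex
  assumes "coprime n m" and "n \<le> m" and "b \<le> 1"
    and "n < m \<or> (n = 1 \<and> m = 1 \<and> cmod z < 1)"
  shows "let a = - (real n / real m);
             b' = (\<lambda>r j. 1 + real r / real m - (b + real j) / real n);
             c = (\<lambda>r j. (real r + 1 + real j) / real m);
             as = (\<lambda>r. 1 # map (\<lambda>j. complex_of_real (b' r j)) [0..<n]);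
             bs = (\<lambda>r. map (\<lambda>j. complex_of_real (c r j)) [0..<m]);
             w = (- 1) ^ n * of_nat n ^ n * z ^ m / of_nat m ^ m
         in summable (wright_term (of_real a) (of_real b) z) \<and>
            (\<forall>r<m. summable (hypergeom_term (as r) (bs r) w)) \<and>
            wright (of_real a) (of_real b) z =
              (\<Sum>r<m. z ^ r / fact r * rGamma (complex_of_real (b + a * real r))
                        * hypergeom (as r) (bs r) w)"
proof -
  define as where "as = (\<lambda>r. 1 # map (\<lambda>j. complex_of_real
    (1 + real r / real m - (b + real j) / real n)) [0..<n])"
  define bs where "bs = (\<lambda>r. map (\<lambda>j. complex_of_real ((real r + 1 + real j) / real m)) [0..<m])"
  define w where "w = (- 1) ^ n * of_nat n ^ n * z ^ m / of_nat m ^ m"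
  define a where "a = - (real n / real m)"
  have "m > 0"
    using assms(4) by auto
  have hyp: "summable (hypergeom_term (as r) (bs r) w)" for r
    using assms(4) by (intro summable_hypergeom_term) (auto simp: as_def bs_def w_def norm_mult)
  have wright_sums: "wright_term (of_real a) (of_real b) z sums
    (\<Sum>r<m. z ^ r / fact r * rGamma (complex_of_real (b + a * real r)) * hypergeom (as r) (bs r) w)"
  proof (rule sums_residue_classes[OF \<open>m > 0\<close>])
    fix r
    have eq: "wright_term (of_real a) (of_real b) z (r + m * l) =
      z ^ r / fact r * rGamma (complex_of_real (b + a * real r)) * hypergeom_term (as r) (bs r) w l" for l
      using wright_term_residue_class[OF \<open>m > 0\<close>, of n "of_real b" z r l]
      by (simp add: a_def as_def bs_def w_def)
    show "(\<lambda>l. wright_term (of_real a) (of_real b) z (r + m * l)) sums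
      (z ^ r / fact r * rGamma (complex_of_real (b + a * real r)) * hypergeom (as r) (bs r) w)"
      unfolding eq hypergeom_def by (intro sums_mult summable_sums hyp)
  qed
  show ?thesis
    unfolding Let_def a_def[symmetric] w_def[symmetric]
      as_def[THEN fun_cong, symmetric] bs_def[THEN fun_cong, symmetric]
    using wright_sums hyp by (auto simp: wright_def sums_iff)
qed

end
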